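(* The $2$-dimensional butterfly network $BF(2)$ has no edge-forcing set.
   Context: The $r$-dimensional butterfly network $BF(r)$ has vertex set $\{[w;i] : w=(x_1,\dots,x_r)\in\{0,1\}^r,\ 0\le i\le r\}$ (vertex $[w;i]$ is at Level $i$), and $[w;i]$ is adjacent to $[w';j]$ iff $j=i+1$ and either $w=w'$ or $w$ and $w'$ differ precisely in the $j$-th bit. Forcing (closure) rule: for a graph $G=(V,E)$ and $T\subseteq V$, the closure $C_G(T)$ is obtained by starting with $C_G(T)=T$ and, as long as some vertex of $C_G(T)$ has exactly one neighbor not in $C_G(T)$, adding that neighbor. Edge-forcing set: a set $K$ of pairwise independent edges (a matching) of $G$ such that, with $T$ the set of endpoints of edges of $K$, $C_G(T)=V$. *)

theory Defs
  imports Main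
begin

text \<open>An edge is the set of its two endpoints; \<open>simple_graph\<close> is the well-formedness condition
  on the raw record.\<close>

record 'a ugraph =
  uverts :: "'a set"
  uedges :: "'a set set"

definition simple_graph :: "'a ugraph \<Rightarrow> bool" where
  "simple_graph G \<longleftrightarrow> finite (uverts G) \<and> (\<forall>e \<in> uedges G. e \<subseteq> uverts G \<and> card e = 2)"

definition neighbors :: "'a ugraph \<Rightarrow> 'a \<Rightarrow> 'a set" where
  "neighbors G u = {v. {u, v} \<in> uedges G}"

definition matching :: "'a ugraph \<Rightarrow> 'a set set \<Rightarrow> bool" where
  "matching G K \<longleftrightarrow> K \<subseteq> uedges G \<and> pairwise disjnt K"

definition forcing_step :: "'a ugraph \<Rightarrow> 'a set \<Rightarrow> 'a set \<Rightarrow> bool" where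
  "forcing_step G S S' \<longleftrightarrow> (\<exists>u \<in> S. \<exists>v. neighbors G u - S = {v} \<and> S' = insert v S)"

definition forcing_result :: "'a ugraph \<Rightarrow> 'a set \<Rightarrow> 'a set \<Rightarrow> bool" where
  "forcing_result G T C \<longleftrightarrow> (forcing_step G)\<^sup>*\<^sup>* T C \<and> (\<nexists>C'. forcing_step G C C')"

text \<open>The forcing process stops, and its result does not depend on the order of the steps:
  see \<open>forcing_result_forcing_closure\<close> and \<open>forcing_closure_eqI\<close> below.\<close>

definition forcing_closure :: "'a ugraph \<Rightarrow> 'a set \<Rightarrow> 'a set" where
  "forcing_closure G T = (THE C. forcing_result G T C)"

definition edge_forcing_set :: "'a ugraph \<Rightarrow> 'a set set \<Rightarrow> bool" where
  "edge_forcing_set G K \<longleftrightarrow> matching G K \<and> forcing_closure G (\<Union>K) = uverts G"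

text \<open>The pair \<open>(w, i)\<close> is the vertex \<open>[w;i]\<close>. List positions start at \<open>0\<close>, so the \<open>j\<close>-th
  bit of \<open>w\<close> for \<open>j = i + 1\<close> is \<open>w ! i\<close>.\<close>

definition butterfly :: "nat \<Rightarrow> (bool list \<times> nat) ugraph" where
  "butterfly r =
    \<lparr>uverts = {(w, i). length w = r \<and> i \<le> r},
     uedges = {{(w, i), (w', i + 1)} | w w' i.
       length w = r \<and> length w' = r \<and> i + 1 \<le> r \<and>
       (w = w' \<or> (\<forall>k < r. w ! k \<noteq> w' ! k \<longleftrightarrow> k = i))}\<rparr>"

lemma simple_graph_butterfly: "simple_graph (butterfly r)"
proof -
  have "{(w :: bool list, i). length w = r \<and> i \<le> r} = {w. set w \<subseteq> UNIV \<and> length w = r} \<times> {..r}"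
    by auto
  then have "finite {(w :: bool list, i). length w = r \<and> i \<le> r}"
    by (simp only: finite_cartesian_product finite_lists_length_eq finite finite_atMost)
  then show ?thesis
    unfolding simple_graph_def butterfly_def by auto
qed

lemma forcing_steps_subset_terminal:
  assumes "(forcing_step G)\<^sup>*\<^sup>* T C" and "T \<subseteq> D" and "\<nexists>D'. forcing_step G D D'"
  shows "C \<subseteq> D"
  using assms(1)
proof (induction rule: rtranclp_induct)
  case base
  then show ?case using assms(2) .
next
  case (step S S')
  then obtain u v where uv: "u \<in> S" "neighbors G u - S = {v}" "S' = insert v S"
    unfolding forcing_step_def by blast
  have "v \<in> D"
  proof (rule ccontr)
    assume "v \<notin> D"
    then have "neighbors G u - D = {v}" using uv step.IH by blast
    then show False using assms(3) uv(1) step.IH unfolding forcing_step_def by blast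
  qed
  then show ?case using uv step.IH by blast
qed

lemma forcing_steps_superset: "(forcing_step G)\<^sup>*\<^sup>* T C \<Longrightarrow> T \<subseteq> C"
  by (induction rule: rtranclp_induct) (auto simp: forcing_step_def)

lemma forcing_result_unique:
  assumes "forcing_result G T C" and "forcing_result G T D"
  shows "C = D"
  using assms forcing_steps_subset_terminal forcing_steps_superset
  unfolding forcing_result_def by (metis subset_antisym)

lemma forcing_closure_eqI: "forcing_result G T C \<Longrightarrow> forcing_closure G T = C"
  unfolding forcing_closure_def using forcing_result_unique by (metis the_equality)

lemma forcing_result_exists:
  assumes "simple_graph G" and "T \<subseteq> uverts G"
  shows "\<exists>C. forcing_result G T C"
  using assms(2)
proof (induction "card (uverts G - T)" arbitrary: T rule: less_induct)
  case less
  show ?case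
  proof (cases "\<exists>T'. forcing_step G T T'")
    case False
    then show ?thesis unfolding forcing_result_def by blast
  next
    case True
    then obtain u v where uv: "u \<in> T" "neighbors G u - T = {v}"
      unfolding forcing_step_def by blast
    then have st: "forcing_step G T (insert v T)"
      unfolding forcing_step_def by blast
    have v: "v \<in> uverts G" "v \<notin> T"
      using uv assms(1) unfolding simple_graph_def neighbors_def by blast+
    have "uverts G - insert v T \<subset> uverts G - T" using v by blast
    then have "card (uverts G - insert v T) < card (uverts G - T)"
      using assms(1) unfolding simple_graph_def by (meson finite_Diff psubset_card_mono)
    then obtain C where "forcing_result G (insert v T) C"
      using less v by blast
    then show ?thesis
      using st unfolding forcing_result_def by (meson converse_rtranclp_into_rtranclp)
  qed
qed

lemma forcing_result_forcing_closure:
  assumes "simple_graph G" and "T \<subseteq> uverts G"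
  shows "forcing_result G T (forcing_closure G T)"
  using forcing_result_exists[OF assms] forcing_closure_eqI by metis

end

theory Submission
  imports Defs
begin

text \<open>Two vertices with the same neighbourhood can never be forced, so an edge-forcing set covers
  one of them. \<open>BF(2)\<close> has two such twin pairs on Level 0 and two on Level 2, whereas Level 1 has only
  four vertices, each of which is an endpoint of at most one matching edge. Hence the matching
  covers Level 1 and exactly one vertex of every twin pair. But then every vertex of
  Level 1 has two uncovered neighbours (one above, one below), every other covered vertex has
  none, and no forcing step is possible.\<close>

text \<open>Trades the definite description in \<open>forcing_closure\<close> for the forcing
  relation; the outcome exists and is unique because the process starts inside a finite vertex
  set.\<close>

lemma forcing_result_edge_forcing_set:
  assumes "simple_graph G" and "edge_forcing_set G K"
  shows "forcing_result G (\<Union>K) (uverts G)"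
proof -
  have "\<Union>K \<subseteq> uverts G"
    using assms unfolding edge_forcing_set_def matching_def simple_graph_def by blast
  then show ?thesis
    using forcing_result_forcing_closure[OF assms(1)] assms(2)
    unfolding edge_forcing_set_def by metis
qed

text \<open>A terminal set traps every forcing process that starts inside it. This serves twice:
  with \<open>D\<close> the complement of a twin pair, and with \<open>D\<close> the covered set
  itself.\<close>

lemma edge_forcing_set_terminal:
  assumes "simple_graph G" and "edge_forcing_set G K"
    and "\<Union>K \<subseteq> D" and "\<nexists>D'. forcing_step G D D'"
  shows "uverts G \<subseteq> D"
  using forcing_result_edge_forcing_set[OF assms(1,2)] assms(3,4) forcing_steps_subset_terminal
  unfolding forcing_result_def by metis

lemma edge_forcing_set_meets_twins:
  assumes G: "simple_graph G" and K: "edge_forcing_set G K"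
    and "u \<in> uverts G" and "u \<noteq> v" and twins: "neighbors G u = neighbors G v"
  shows "u \<in> \<Union>K \<or> v \<in> \<Union>K"
proof (rule ccontr)
  assume uncovered: "\<not> (u \<in> \<Union>K \<or> v \<in> \<Union>K)"
  have sym: "x \<in> neighbors G y \<longleftrightarrow> y \<in> neighbors G x" for x y
    unfolding neighbors_def by (simp add: insert_commute)
  \<comment> \<open>A vertex adjacent to one twin is adjacent to both, so it has zero or two
    neighbours outside \<open>- {u, v}\<close>, never exactly one.\<close>
  have "\<nexists>D'. forcing_step G (- {u, v}) D'"
  proof -
    have "u \<in> neighbors G w \<longleftrightarrow> v \<in> neighbors G w" for w
      using sym[of u w] sym[of v w] twins by simp
    then have "neighbors G w - - {u, v} \<noteq> {z}" for w z
      using \<open>u \<noteq> v\<close> by (cases "u \<in> neighbors G w") auto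
    then show ?thesis unfolding forcing_step_def by blast
  qed
  moreover have "\<Union>K \<subseteq> - {u, v}" using uncovered by blast
  ultimately have "uverts G \<subseteq> - {u, v}" using edge_forcing_set_terminal[OF G K] by metis
  then show False using \<open>u \<in> uverts G\<close> by blast
qed

lemma uedges_butterfly_2:
  "uedges (butterfly 2) =
     {{([x, y], 0), ([x', y], 1)} | x x' y. True} \<union> {{([x, y], 1), ([x, y'], 2)} | x y y'. True}"
  (is "?E = ?A \<union> ?B")
proof (intro equalityI subsetI)
  fix e assume "e \<in> ?E"
  then obtain w w' i where e: "e = {(w, i), (w', i + 1)}" and "length w = 2" "length w' = 2"
    and i: "i + 1 \<le> 2" and flip: "w = w' \<or> (\<forall>k < 2. w ! k \<noteq> w' ! k \<longleftrightarrow> k = i)"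
    unfolding butterfly_def by auto
  then obtain x y x' y' where w: "w = [x, y]" "w' = [x', y']"
    by (auto simp: length_Suc_conv numeral_2_eq_2)
  consider "i = 0" | "i = 1" using i by linarith
  then show "e \<in> ?A \<union> ?B"
  proof cases
    case 1
    then have "y = y'" using flip w by (auto dest: spec[of _ 1])
    then show ?thesis using e w 1 by auto
  next
    case 2
    then have "x = x'" using flip w by (auto dest: spec[of _ 0])
    then have "e = {([x, y], 1), ([x, y'], 2)}" using e w 2 by (simp add: numeral_2_eq_2)
    then show ?thesis by blast
  qed
next
  have upper: "{([x, y], 0), ([x', y], 1)} \<in> ?E" for x x' y
  proof -
    have "\<forall>k < 2. x \<noteq> x' \<longrightarrow> ([x, y] ! k \<noteq> [x', y] ! k \<longleftrightarrow> k = 0)"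
      by (simp add: less_2_cases_iff)
    then show ?thesis
      unfolding butterfly_def ugraph.simps mem_Collect_eq
      by (intro exI[of _ "[x, y]"] exI[of _ "[x', y]"] exI[of _ 0]) auto
  qed
  have lower: "{([x, y], 1), ([x, y'], 2)} \<in> ?E" for x y y'
  proof -
    have "\<forall>k < 2. y \<noteq> y' \<longrightarrow> ([x, y] ! k \<noteq> [x, y'] ! k \<longleftrightarrow> k = 1)"
      by (simp add: less_2_cases_iff)
    then show ?thesis
      \<comment> \<open>Writing \<open>2\<close> as \<open>1 + 1\<close> shows the level in the form
        \<open>i + 1\<close> for the witness \<open>i = 1\<close>.\<close>
      unfolding butterfly_def ugraph.simps mem_Collect_eq one_add_one[symmetric, where 'a = nat]
      by (intro exI[of _ "[x, y]"] exI[of _ "[x, y']"] exI[of _ 1]) auto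
  qed
  fix e assume "e \<in> ?A \<union> ?B"
  then show "e \<in> ?E" using upper lower by (elim UnE CollectE exE conjE) simp_all
qed

text \<open>The source of the twins: \<open>x\<close> is absent from the right-hand side at Level 0,
  and \<open>y\<close> at Level 2.\<close>

lemma neighbors_butterfly_2:
  shows "neighbors (butterfly 2) ([x, y], 0) = {([x', y], 1) | x'. True}"
    and "neighbors (butterfly 2) ([x, y], 1) =
      {([x', y], 0) | x'. True} \<union> {([x, y'], 2) | y'. True}"
    and "neighbors (butterfly 2) ([x, y], 2) = {([x, y'], 1) | y'. True}"
  unfolding neighbors_def uedges_butterfly_2 by (auto simp: doubleton_eq_iff)

lemma matching_partner:
  assumes "simple_graph G" and "matching G K" and "u \<in> \<Union>K"
  shows "\<exists>v \<in> neighbors G u. {u, v} \<in> K"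
proof -
  obtain e where e: "e \<in> K" "u \<in> e" "e \<in> uedges G"
    using assms(2,3) unfolding matching_def by blast
  then have "card e = 2" using assms(1) unfolding simple_graph_def by blast
  then obtain v where "e = {u, v}" using \<open>u \<in> e\<close> by (auto simp: card_2_iff)
  then show ?thesis using e unfolding neighbors_def by blast
qed

theorem theorem4p1: "\<nexists>K. edge_forcing_set (butterfly 2) K"
proof
  assume "\<exists>K. edge_forcing_set (butterfly 2) K"
  then obtain K where K: "edge_forcing_set (butterfly 2) K" by blast
  let ?T = "\<Union>K"
  have matching: "matching (butterfly 2) K"
    using K unfolding edge_forcing_set_def by blast
  have same: "e = f" if "e \<in> K" "f \<in> K" "z \<in> e" "z \<in> f" for e f z
    using matching that unfolding matching_def pairwise_def disjnt_def by blast
  note meets = edge_forcing_set_meets_twins[OF simple_graph_butterfly K]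
  have verts: "([x, y], i) \<in> uverts (butterfly 2) \<longleftrightarrow> i \<le> 2" for x y i
    unfolding butterfly_def by simp
  note partner = matching_partner[OF simple_graph_butterfly matching]
  have partner0: "\<exists>x'. {([x, y], 0), ([x', y], 1)} \<in> K" if T: "([x, y], 0) \<in> ?T" for x y
    using partner[OF T] unfolding neighbors_butterfly_2(1) by fast
  have partner2: "\<exists>y'. {([x, y'], 1), ([x, y], 2)} \<in> K" if T: "([x, y], 2) \<in> ?T" for x y
    using partner[OF T] unfolding neighbors_butterfly_2(3) by (auto simp: insert_commute)
  have "\<exists>x. ([x, y], 0) \<in> ?T" for y
    using meets[of "([True, y], 0)" "([False, y], 0)"] verts neighbors_butterfly_2(1) by auto
  then have "\<exists>x x'. {([x, y], 0), ([x', y], 1)} \<in> K" for y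
    using partner0 by meson
  \<comment> \<open>For each twin pair on Level 0, indexed by its common bit \<open>y\<close>,
    \<open>a y\<close> picks a covered twin and \<open>p y\<close> its partner on Level 1. Below,
    \<open>b\<close> and \<open>q\<close> do the same for Level 2, indexed by
    \<open>x\<close>.\<close>
  then obtain a p where up: "{([a y, y], 0), ([p y, y], 1)} \<in> K" for y by metis
  have "\<exists>y. ([x, y], 2) \<in> ?T" for x
    using meets[of "([x, True], 2)" "([x, False], 2)"] verts neighbors_butterfly_2(3) by auto
  then have "\<exists>y y'. {([x, y'], 1), ([x, y], 2)} \<in> K" for x
    using partner2 by meson
  then obtain b q where down: "{([x, q x], 1), ([x, b x], 2)} \<in> K" for x by metis
  \<comment> \<open>Otherwise one Level 1 vertex would lie on an edge going to Level 0 and on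
    another going to Level 2.\<close>
  have "\<not> (p y = x \<and> q x = y)" for x y
  proof
    assume "p y = x \<and> q x = y"
    then show False
      using same[OF up[of y] down[of x], of "([x, y], 1)"] by (simp add: doubleton_eq_iff)
  qed
  \<comment> \<open>The two vertices \<open>[p y, y; 1]\<close> and the two vertices \<open>[x, q x; 1]\<close> are distinct, so they
    exhaust Level 1.\<close>
  then have cover: "p y = x \<or> q x = y" for x y
    by (cases x; cases y) metis+
  have level1: "([x, y], 1) \<in> ?T" for x y
    using cover[of y x]
  proof
    assume "p y = x"
    then show ?thesis by (intro UnionI[OF up[of y]]) simp
  next
    assume "q x = y"
    then show ?thesis by (intro UnionI[OF down[of x]]) simp
  qed
  \<comment> \<open>The Level 1 end of the matching edge at this vertex already lies on a chosen
    edge, so the two edges coincide. A \<open>down\<close> edge misses Level 0, hence it is the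
    \<open>up\<close> edge and the vertex is the chosen twin.\<close>
  have level0: "x = a y" if T: "([x, y], 0) \<in> ?T" for x y
  proof -
    obtain x' where e: "{([x, y], 0), ([x', y], 1)} \<in> K" using partner0 T by blast
    show ?thesis using cover[of y x']
    proof
      assume "p y = x'"
      then show ?thesis
        using same[OF e up[of y], of "([x', y], 1)"] by (simp add: doubleton_eq_iff)
    next
      assume "q x' = y"
      then show ?thesis
        using same[OF e down[of x'], of "([x', y], 1)"] by (simp add: doubleton_eq_iff)
    qed
  qed
  have level2: "y = b x" if T: "([x, y], 2) \<in> ?T" for x y
  proof -
    obtain y' where e: "{([x, y'], 1), ([x, y], 2)} \<in> K" using partner2 T by blast
    show ?thesis using cover[of y' x]
    proof
      assume "p y' = x"
      then show ?thesis
        using same[OF e up[of y'], of "([x, y'], 1)"] by (simp add: doubleton_eq_iff)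
    next
      assume "q x = y'"
      then show ?thesis
        using same[OF e down[of x], of "([x, y'], 1)"] by (simp add: doubleton_eq_iff)
    qed
  qed
  have free0: "([\<not> a y, y], 0) \<notin> ?T" for y using level0 by blast
  have free2: "([x, \<not> b x], 2) \<notin> ?T" for x using level2 by blast
  have "neighbors (butterfly 2) u - ?T \<noteq> {v}" if T: "u \<in> ?T" for u v
  proof -
    have "u \<in> uverts (butterfly 2)"
      using T matching simple_graph_butterfly[of 2]
      unfolding matching_def simple_graph_def by blast
    then have "length (fst u) = 2" and "snd u \<le> 2"
      unfolding butterfly_def by auto
    then obtain x y i where "u = ([x, y], i)" and "i \<le> 2"
      by (cases u) (auto simp: length_Suc_conv numeral_2_eq_2)
    moreover from \<open>i \<le> 2\<close> have "i = 0 \<or> i = 1 \<or> i = 2" by linarith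
    ultimately consider x y where "u = ([x, y], 0)" | x y where "u = ([x, y], 1)"
      | x y where "u = ([x, y], 2)"
      by metis
    then show ?thesis
    proof cases
      case (1 x y)
      have "neighbors (butterfly 2) u \<subseteq> ?T"
        unfolding 1 neighbors_butterfly_2(1) using level1 by fast
      then show ?thesis by blast
    next
      case (2 x y)
      have "([\<not> a y, y], 0) \<in> neighbors (butterfly 2) u - ?T"
        and "([x, \<not> b x], 2) \<in> neighbors (butterfly 2) u - ?T"
        unfolding 2 neighbors_butterfly_2(2) using free0[of y] free2[of x] by simp_all
      then show ?thesis by (metis singletonD prod.inject zero_neq_numeral)
    next
      case (3 x y)
      have "neighbors (butterfly 2) u \<subseteq> ?T"
        unfolding 3 neighbors_butterfly_2(3) using level1 by fast
      then show ?thesis by blast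
    qed
  qed
  \<comment> \<open>The covered set is thus terminal and would have to contain every vertex, but the
    unchosen twins on Level 0 lie outside it.\<close>
  then have "\<nexists>D'. forcing_step (butterfly 2) ?T D'"
    unfolding forcing_step_def by blast
  then have "uverts (butterfly 2) \<subseteq> ?T"
    using edge_forcing_set_terminal[OF simple_graph_butterfly K] by blast
  then show False using free0 verts by blast
qed

end
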